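(* Let $E$ be an arbitrary directed graph, $K$ a field, and $L=L_K(E)$ the Leavitt path algebra of $E$ over $K$. Suppose $A=P_1\cap\cdots\cap P_m=Q_1\cap\cdots\cap Q_n$ are two representations of a proper two-sided ideal $A$ of $L$ as irredundant intersections of finitely many prime ideals $P_i$ and $Q_j$ of $L$. Then $m=n$ and $\{P_1,\ldots,P_m\}=\{Q_1,\ldots,Q_m\}$.
   Context: A directed graph $E=(E^0,E^1,r,s)$ consists of sets $E^0$ (vertices) and $E^1$ (edges), of arbitrary cardinality, with maps $r,s:E^1\to E^0$ (range, source). A vertex $v$ is regular if $s^{-1}(v)$ is finite and non-empty. The Leavitt path algebra $L_K(E)$ is the (not necessarily unital) $K$-algebra generated by pairwise orthogonal idempotents $\{v:v\in E^0\}$ and elements $\{e,e^*:e\in E^1\}$ subject to: (1) $s(e)e=e=er(e)$; (2) $r(e)e^*=e^*=e^*s(e)$; (3) $e^*e=r(e)$ and $e^*f=0$ for edges $e\ne f$; (4) $v=\sum_{s(e)=v}ee^*$ for every regular vertex $v$. Ideals are two-sided. A proper ideal $P$ is prime if for all two-sided ideals $A,B$, $AB\subseteq P$ implies $A\subseteq P$ or $B\subseteq P$. An intersection $P_1\cap\cdots\cap P_m$ is irredundant if no $P_i$ contains the intersection of the other $m-1$ ideals $P_j$, $j\neq i$. *)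

theory Defs
  imports
    "HOL-Library.Poly_Mapping"
    "HOL-Algebra.QuotRing"
    "HOL-Algebra.Ideal_Product"
    "HOL-Algebra.Module"
    "Graph_Theory.Digraph"
begin

section \<open>Ideals of rings without a unit\<close>

text \<open>
  The locales \<open>ideal\<close> and \<open>primeideal\<close> of HOL-Algebra presuppose a unital (and, for
  \<open>primeideal\<close>, commutative) ring. Leavitt path algebras are in general neither, so the notions
  are stated here on ring records without any reference to the field \<open>one\<close>.
\<close>

definition two_sided_ideal :: "('a, 'b) ring_scheme \<Rightarrow> 'a set \<Rightarrow> bool" where
  "two_sided_ideal R I \<longleftrightarrow>
     additive_subgroup I R \<and>
     (\<forall>x \<in> carrier R. \<forall>a \<in> I. x \<otimes>\<^bsub>R\<^esub> a \<in> I \<and> a \<otimes>\<^bsub>R\<^esub> x \<in> I)"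

text \<open>
  \<open>ideal_prod R A B\<close> is the set of finite sums of products \<open>a b\<close> with \<open>a \<in> A\<close> and \<open>b \<in> B\<close>.
\<close>

definition two_sided_prime :: "('a, 'b) ring_scheme \<Rightarrow> 'a set \<Rightarrow> bool" where
  "two_sided_prime R P \<longleftrightarrow>
     two_sided_ideal R P \<and> P \<noteq> carrier R \<and>
     (\<forall>A B. two_sided_ideal R A \<longrightarrow> two_sided_ideal R B \<longrightarrow>
        ideal_prod R A B \<subseteq> P \<longrightarrow> A \<subseteq> P \<or> B \<subseteq> P)"

text \<open>The intersection of a family of ideals; the empty intersection is the whole ring.\<close>

definition ideal_Inter :: "('a, 'b) ring_scheme \<Rightarrow> 'i set \<Rightarrow> ('i \<Rightarrow> 'a set) \<Rightarrow> 'a set" where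
  "ideal_Inter R J P = carrier R \<inter> (\<Inter>j\<in>J. P j)"

definition irredundant :: "('a, 'b) ring_scheme \<Rightarrow> 'i set \<Rightarrow> ('i \<Rightarrow> 'a set) \<Rightarrow> bool" where
  "irredundant R J P \<longleftrightarrow> (\<forall>i\<in>J. \<not> ideal_Inter R (J - {i}) P \<subseteq> P i)"


section \<open>Free algebras\<close>

text \<open>
  \<open>'g word \<Rightarrow>\<^sub>0 'k\<close> is the free unital algebra on \<open>'g\<close>: finitely supported functions on the
  free monoid, with the convolution product of \<open>Poly_Mapping\<close>, for which the monoid has to be
  written additively.
\<close>

datatype 'g word = Word (letters: "'g list")

instantiation word :: (type) monoid_add
begin

definition zero_word :: "'a word" where
  "0 = Word []"

definition plus_word :: "'a word \<Rightarrow> 'a word \<Rightarrow> 'a word" where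
  "u + w = Word (letters u @ letters w)"

instance
  by standard (simp_all add: zero_word_def plus_word_def)

end

definition gen :: "'g \<Rightarrow> 'g word \<Rightarrow>\<^sub>0 'k::field" where
  "gen x = Poly_Mapping.single (Word [x]) 1"

text \<open>Multiplication by a scalar is multiplication by the corresponding constant.\<close>

definition scale :: "'k::field \<Rightarrow> ('g word \<Rightarrow>\<^sub>0 'k) \<Rightarrow> 'g word \<Rightarrow>\<^sub>0 'k" where
  "scale c p = Poly_Mapping.single 0 c * p"

text \<open>
  The free algebra without unit on the generators in \<open>X\<close>: linear combinations of nonempty words
  with letters in \<open>X\<close>. The record type demands a field \<open>one\<close>; there is no unit to put there, and
  nothing below depends on its value.
\<close>

definition free_algebra :: "'g set \<Rightarrow> ('k::field, 'g word \<Rightarrow>\<^sub>0 'k) module" where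
  "free_algebra X =
     \<lparr>carrier = {p. \<forall>w \<in> Poly_Mapping.keys p. letters w \<noteq> [] \<and> set (letters w) \<subseteq> X},
      mult = (*), one = undefined, zero = 0, add = (+), smult = scale\<rparr>"

text \<open>The two-sided algebra ideal of \<open>free_algebra X\<close> generated by \<open>S\<close>.\<close>

inductive_set generated_ideal ::
  "'g set \<Rightarrow> ('g word \<Rightarrow>\<^sub>0 'k::field) set \<Rightarrow> ('g word \<Rightarrow>\<^sub>0 'k) set"
  for X :: "'g set" and S :: "('g word \<Rightarrow>\<^sub>0 'k::field) set"
where
  zero: "0 \<in> generated_ideal X S"
| base: "p \<in> S \<Longrightarrow> p \<in> generated_ideal X S"
| add: "p \<in> generated_ideal X S \<Longrightarrow> q \<in> generated_ideal X S \<Longrightarrow> p + q \<in> generated_ideal X S"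
| scale: "p \<in> generated_ideal X S \<Longrightarrow> scale c p \<in> generated_ideal X S"
| left: "a \<in> carrier (free_algebra X :: ('k, 'g word \<Rightarrow>\<^sub>0 'k) module) \<Longrightarrow>
    p \<in> generated_ideal X S \<Longrightarrow> a * p \<in> generated_ideal X S"
| right: "a \<in> carrier (free_algebra X :: ('k, 'g word \<Rightarrow>\<^sub>0 'k) module) \<Longrightarrow>
    p \<in> generated_ideal X S \<Longrightarrow> p * a \<in> generated_ideal X S"

text \<open>
  \<open>Quot\<close> truncates its result to the type of plain ring records, so scalar multiplication of
  cosets is added back, in the style of \<open>rcoset_mult\<close>.
\<close>

definition presented_algebra ::
  "'g set \<Rightarrow> ('g word \<Rightarrow>\<^sub>0 'k::field) set \<Rightarrow> ('k, ('g word \<Rightarrow>\<^sub>0 'k) set) module" where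
  "presented_algebra X S =
     (let F = free_algebra X; I = generated_ideal X S
      in ring.extend (F Quot I) (module.fields (\<lambda>c A. \<Union>a\<in>A. I +>\<^bsub>F\<^esub> (c \<odot>\<^bsub>F\<^esub> a))))"


section \<open>Leavitt path algebras\<close>

text \<open>
  Directed graphs are those of \<open>Graph_Theory\<close>: \<open>E\<^sup>0 = verts E\<close>, \<open>E\<^sup>1 = arcs E\<close>,
  \<open>s = tail E\<close>, \<open>r = head E\<close>.
\<close>

definition regular :: "('v, 'e) pre_digraph \<Rightarrow> 'v \<Rightarrow> bool" where
  "regular E v \<longleftrightarrow> v \<in> verts E \<and> finite (out_arcs E v) \<and> out_arcs E v \<noteq> {}"

datatype ('v, 'e) lpa_gen = Vertex 'v | Edge 'e | Ghost 'e

definition lpa_gens :: "('v, 'e) pre_digraph \<Rightarrow> ('v, 'e) lpa_gen set" where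
  "lpa_gens E = Vertex ` verts E \<union> Edge ` arcs E \<union> Ghost ` arcs E"

definition lpa_rels ::
  "('v, 'e) pre_digraph \<Rightarrow> (('v, 'e) lpa_gen word \<Rightarrow>\<^sub>0 'k::field) set" where
  "lpa_rels E =
     {gen (Vertex v) * gen (Vertex v) - gen (Vertex v) | v. v \<in> verts E} \<union>
     {gen (Vertex v) * gen (Vertex w) | v w. v \<in> verts E \<and> w \<in> verts E \<and> v \<noteq> w} \<union>
     {gen (Vertex (tail E e)) * gen (Edge e) - gen (Edge e) | e. e \<in> arcs E} \<union>
     {gen (Edge e) * gen (Vertex (head E e)) - gen (Edge e) | e. e \<in> arcs E} \<union>
     {gen (Vertex (head E e)) * gen (Ghost e) - gen (Ghost e) | e. e \<in> arcs E} \<union>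
     {gen (Ghost e) * gen (Vertex (tail E e)) - gen (Ghost e) | e. e \<in> arcs E} \<union>
     {gen (Ghost e) * gen (Edge e) - gen (Vertex (head E e)) | e. e \<in> arcs E} \<union>
     {gen (Ghost e) * gen (Edge f) | e f. e \<in> arcs E \<and> f \<in> arcs E \<and> e \<noteq> f} \<union>
     {gen (Vertex v) - (\<Sum>e\<in>out_arcs E v. gen (Edge e) * gen (Ghost e)) | v. regular E v}"

definition leavitt_path_algebra ::
  "('v, 'e) pre_digraph \<Rightarrow> ('k::field, (('v, 'e) lpa_gen word \<Rightarrow>\<^sub>0 'k) set) module" where
  "leavitt_path_algebra E = presented_algebra (lpa_gens E) (lpa_rels E)"

end

theory Submission
  imports Defs
begin

text \<open>
  The argument is valid in every ring. A prime ideal containing a finite intersection of ideals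
  contains one of them, because products of ideals lie in their intersection. Hence every \<open>P i\<close>
  contains some \<open>Q j\<close>, which in turn contains some \<open>P k\<close>; irredundancy forces \<open>k = i\<close> and so
  \<open>P i = Q j\<close>.
\<close>

lemma two_sided_ideal_Int:
  assumes "two_sided_ideal R I" and "two_sided_ideal R J"
  shows "two_sided_ideal R (I \<inter> J)"
  using assms unfolding two_sided_ideal_def additive_subgroup_def
  by (auto simp: subgroup_def)

lemma two_sided_ideal_subset_carrier: "two_sided_ideal R I \<Longrightarrow> I \<subseteq> carrier R"
  by (auto simp: two_sided_ideal_def additive_subgroup_def subgroup_def)

text \<open>The empty \<open>\<Inter>\<close> is the whole type, not the carrier, so the induction
  has to start from a singleton.\<close>

lemma two_sided_ideal_INT:
  assumes "finite J" and "J \<noteq> {}" and "\<And>j. j \<in> J \<Longrightarrow> two_sided_ideal R (I j)"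
  shows "two_sided_ideal R (\<Inter>j\<in>J. I j)"
  using assms by (induction J rule: finite_ne_induct) (auto intro: two_sided_ideal_Int)

text \<open>In a product \<open>i \<otimes> j\<close> either factor may be regarded as a mere ring
  element, so each of the two ideals absorbs it; finite sums stay inside because ideals are
  additively closed.\<close>

lemma ideal_prod_subset_Int:
  assumes I: "two_sided_ideal R I" and J: "two_sided_ideal R J"
  shows "ideal_prod R I J \<subseteq> I \<inter> J"
proof
  fix x assume "x \<in> ideal_prod R I J"
  then show "x \<in> I \<inter> J"
  proof induction
    case (prod i j)
    then show ?case
      using I J two_sided_ideal_subset_carrier[OF I] two_sided_ideal_subset_carrier[OF J]
      by (auto simp: two_sided_ideal_def)
  next
    case (sum s1 s2)
    then show ?case
      using I J by (auto simp: two_sided_ideal_def intro: additive_subgroup.a_closed)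
  qed
qed

lemma two_sided_prime_Int_subsetD:
  assumes "two_sided_prime R P" and I: "two_sided_ideal R I" and J: "two_sided_ideal R J"
    and "I \<inter> J \<subseteq> P"
  shows "I \<subseteq> P \<or> J \<subseteq> P"
  using assms ideal_prod_subset_Int[OF I J] unfolding two_sided_prime_def by blast

lemma two_sided_prime_INT_subsetD:
  assumes P: "two_sided_prime R P"
    and "finite J" and "J \<noteq> {}" and "\<And>j. j \<in> J \<Longrightarrow> two_sided_ideal R (I j)"
    and "(\<Inter>j\<in>J. I j) \<subseteq> P"
  shows "\<exists>j\<in>J. I j \<subseteq> P"
  using assms(2-)
proof (induction J rule: finite_ne_induct)
  case (singleton j)
  then show ?case by simp
next
  case (insert j J)
  \<comment> \<open>Primeness can separate \<open>I j\<close> from the remaining intersection only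
    if the latter is itself an ideal.\<close>
  have "two_sided_ideal R (\<Inter>j\<in>J. I j)"
    using insert by (intro two_sided_ideal_INT) auto
  with insert.prems have "I j \<subseteq> P \<or> (\<Inter>j\<in>J. I j) \<subseteq> P"
    by (intro two_sided_prime_Int_subsetD[OF P]) auto
  then show ?case using insert by auto
qed

lemma two_sided_prime_ideal_Inter_subsetD:
  assumes P: "two_sided_prime R P" and "finite J"
    and I: "\<And>j. j \<in> J \<Longrightarrow> two_sided_ideal R (I j)"
    and sub: "ideal_Inter R J I \<subseteq> P"
  shows "\<exists>j\<in>J. I j \<subseteq> P"
proof -
  \<comment> \<open>Properness of \<open>P\<close> rules out the empty family, whose
    \<open>ideal_Inter\<close> is the carrier. For nonempty \<open>J\<close> the intersection with
    the carrier then changes nothing.\<close>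
  have "\<not> carrier R \<subseteq> P"
    using P two_sided_ideal_subset_carrier unfolding two_sided_prime_def by blast
  with sub have ne: "J \<noteq> {}" by (auto simp: ideal_Inter_def)
  then have "(\<Inter>j\<in>J. I j) \<subseteq> carrier R"
    using I two_sided_ideal_subset_carrier by blast
  with sub have "(\<Inter>j\<in>J. I j) \<subseteq> P" by (auto simp: ideal_Inter_def)
  with ne I show ?thesis by (intro two_sided_prime_INT_subsetD[OF P \<open>finite J\<close>])
qed

text \<open>If \<open>i\<close> and \<open>j\<close> differed, \<open>P i\<close> would still occur
  after dropping \<open>P j\<close>, so the intersection of the others would lie in
  \<open>P i\<close> and hence in \<open>P j\<close>.\<close>

lemma irredundant_subset_imp_eq:
  assumes "irredundant R J P" and "i \<in> J" and "j \<in> J" and "P i \<subseteq> P j"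
  shows "i = j"
proof (rule ccontr)
  assume "i \<noteq> j"
  with assms(2) have "ideal_Inter R (J - {j}) P \<subseteq> P i" by (auto simp: ideal_Inter_def)
  with assms show False unfolding irredundant_def by blast
qed

text \<open>One half of the uniqueness; exchanging the two families gives the reverse
  inclusion.\<close>

lemma irredundant_primes_subset:
  assumes "finite I" and "finite J"
    and P: "\<And>i. i \<in> I \<Longrightarrow> two_sided_prime R (P i)"
    and Q: "\<And>j. j \<in> J \<Longrightarrow> two_sided_prime R (Q j)"
    and eq: "ideal_Inter R I P = ideal_Inter R J Q"
    and irr: "irredundant R I P"
  shows "P ` I \<subseteq> Q ` J"
proof
  fix x assume "x \<in> P ` I"
  then obtain i where i: "i \<in> I" and x: "x = P i" by blast
  have "ideal_Inter R J Q \<subseteq> P i" using i unfolding eq[symmetric] by (auto simp: ideal_Inter_def)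
  then obtain j where j: "j \<in> J" "Q j \<subseteq> P i"
    using two_sided_prime_ideal_Inter_subsetD[OF P[OF i] \<open>finite J\<close>] Q
    unfolding two_sided_prime_def by blast
  have "ideal_Inter R I P \<subseteq> Q j" using j unfolding eq by (auto simp: ideal_Inter_def)
  then obtain k where k: "k \<in> I" "P k \<subseteq> Q j"
    using two_sided_prime_ideal_Inter_subsetD[OF Q[OF j(1)] \<open>finite I\<close>] P
    unfolding two_sided_prime_def by blast
  have "k = i" using irredundant_subset_imp_eq[OF irr k(1) i] j(2) k(2) by blast
  with j k x show "x \<in> Q ` J" by blast
qed

text \<open>Equal members contain one another, so an irredundant family has no repetitions.\<close>

lemma irredundant_imp_inj_on: "irredundant R J P \<Longrightarrow> inj_on P J"
  by (rule inj_onI) (rule irredundant_subset_imp_eq, auto)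

theorem proposition2p6:
  fixes E :: "('v, 'e) pre_digraph"
    and L :: "('k::field, (('v, 'e) lpa_gen word \<Rightarrow>\<^sub>0 'k) set) module"
    and A :: "(('v, 'e) lpa_gen word \<Rightarrow>\<^sub>0 'k) set set"
    and P Q :: "nat \<Rightarrow> (('v, 'e) lpa_gen word \<Rightarrow>\<^sub>0 'k) set set"
    and m n :: nat
  assumes "wf_digraph E"
    and "L = leavitt_path_algebra E"
    and "two_sided_ideal L A" and "A \<noteq> carrier L"
    and "\<And>i. i \<in> {1..m} \<Longrightarrow> two_sided_prime L (P i)"
    and "\<And>j. j \<in> {1..n} \<Longrightarrow> two_sided_prime L (Q j)"
    and "A = ideal_Inter L {1..m} P" and "irredundant L {1..m} P"
    and "A = ideal_Inter L {1..n} Q" and "irredundant L {1..n} Q"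
  shows "m = n \<and> P ` {1..m} = Q ` {1..m}"
proof -
  have eq: "ideal_Inter L {1..m} P = ideal_Inter L {1..n} Q" using assms(7,9) by simp
  have "P ` {1..m} \<subseteq> Q ` {1..n}"
    using assms(5,6,8) by (intro irredundant_primes_subset[OF _ _ _ _ eq]) auto
  moreover have "Q ` {1..n} \<subseteq> P ` {1..m}"
    using assms(5,6,10) by (intro irredundant_primes_subset[OF _ _ _ _ eq[symmetric]]) auto
  ultimately have img: "P ` {1..m} = Q ` {1..n}" by (rule subset_antisym)
  \<comment> \<open>Without repetitions, \<open>m\<close> and \<open>n\<close> both count the
    elements of one and the same set of ideals.\<close>
  have "card (P ` {1..m}) = m" "card (Q ` {1..n}) = n"
    using assms(8,10) by (simp_all add: card_image irredundant_imp_inj_on)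
  with img show ?thesis by simp
qed

end
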